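(* Let $\mathscr{H}$ be a reproducing kernel Hilbert space over a nonempty set $\Omega$, let $q\in(0,1)$, $\theta\in[0,\frac{\pi}{2})$, and let $S,T\in\mathscr{B}(\mathscr{H})$ be such that $T^*S\in\Pi_\theta^{\mathbf{Ber}_q}$. Then $$\mathbf{ber}_q(S^*S+T^*T)\le\|S-iT\|^2+2\bigg(\Big(\sin\theta+\frac{4\sqrt{1-q^2}}{q}\Big)\mathbf{ber}_q(T^*S)+\sqrt{1-q^2}\,\|\Im(T^*S)\|\bigg).$$
   Context: A reproducing kernel Hilbert space $\mathscr{H}$ over $\Omega$ is a Hilbert space of complex-valued functions on $\Omega$ with continuous point evaluations; $k_\lambda\in\mathscr{H}$ ($\lambda\in\Omega$) denotes the reproducing kernel, $\phi(\lambda)=\langle\phi,k_\lambda\rangle$ for all $\phi\in\mathscr{H}$, and $\hat k_\lambda=k_\lambda/\|k_\lambda\|$. $\mathscr{B}(\mathscr{H})$ is the space of bounded linear operators on $\mathscr{H}$; $\|\cdot\|$ is the operator norm; $\Im(A)=\frac1{2i}(A-A^* )$. For $q\in(0,1]$, $\mathbf{Ber}_q(A)=\{\langle A\hat k_\lambda,\hat k_\mu\rangle:\lambda,\mu\in\Omega,\ \langle\hat k_\lambda,\hat k_\mu\rangle=q\}$ (assumed nonempty) and $\mathbf{ber}_q(A)=\sup\{|z|:z\in\mathbf{Ber}_q(A)\}$. For $\theta\in[0,\frac\pi2)$, $S_\theta=\{z\in\mathbb{C}:|\arg z|\le\theta\}=\{z:\Re z>0,\ |\Im z|\le\tan\theta\,\Re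 z\}$. $\Pi_\theta^{\mathbf{Ber}_q}$ is the set of operators $A$ with $\mathbf{Ber}_q(A)\subseteq S_\theta$. *)

theory Defs
  imports "HOL-Analysis.Analysis" "HOL-Library.Function_Algebras"
begin

text \<open>
  Sums and differences of functions, and of operators on functions, are the pointwise ones
  of Function_Algebras.  A Hilbert space of functions is given by its carrier \<open>H\<close> and its inner
  product \<open>ip\<close>, complex linear in the first argument; operators are only meaningful on \<open>H\<close>.
\<close>

definition scale_fun :: "complex \<Rightarrow> ('a \<Rightarrow> complex) \<Rightarrow> 'a \<Rightarrow> complex" (infixr "\<cdot>\<^sub>F" 75)
  where "c \<cdot>\<^sub>F f = (\<lambda>x. c * f x)"

definition scale_op ::
    "complex \<Rightarrow> (('a \<Rightarrow> complex) \<Rightarrow> 'a \<Rightarrow> complex) \<Rightarrow> ('a \<Rightarrow> complex) \<Rightarrow> 'a \<Rightarrow> complex" (infixr "\<cdot>\<^sub>O" 75)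
  where "c \<cdot>\<^sub>O A = (\<lambda>f. c \<cdot>\<^sub>F A f)"

type_synonym 'a inner_prod = "('a \<Rightarrow> complex) \<Rightarrow> ('a \<Rightarrow> complex) \<Rightarrow> complex"
type_synonym 'a operator = "('a \<Rightarrow> complex) \<Rightarrow> 'a \<Rightarrow> complex"

definition hnorm :: "'a inner_prod \<Rightarrow> ('a \<Rightarrow> complex) \<Rightarrow> real"
  where "hnorm ip f = sqrt (Re (ip f f))"

text \<open>
  The locale Metric_space requires nonnegativity and symmetry of the distance also outside of the
  carrier, hence the value \<open>0\<close> there.
\<close>

definition hdist ::
    "('a \<Rightarrow> complex) set \<Rightarrow> 'a inner_prod \<Rightarrow> ('a \<Rightarrow> complex) \<Rightarrow> ('a \<Rightarrow> complex) \<Rightarrow> real"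
  where "hdist H ip f g = (if f \<in> H \<and> g \<in> H then hnorm ip (f - g) else 0)"

text \<open>
  A function on \<open>\<Omega>\<close> is represented by its extension by zero to the whole type.
\<close>

locale rkhs =
  fixes \<Omega> :: "'a set" and H :: "('a \<Rightarrow> complex) set" and ip :: "'a inner_prod"
  assumes nonempty: "\<Omega> \<noteq> {}"
    and support: "\<And>f x. f \<in> H \<Longrightarrow> x \<notin> \<Omega> \<Longrightarrow> f x = 0"
    and zero_mem: "0 \<in> H"
    and add_mem: "\<And>f g. f \<in> H \<Longrightarrow> g \<in> H \<Longrightarrow> f + g \<in> H"
    and scale_mem: "\<And>c f. f \<in> H \<Longrightarrow> c \<cdot>\<^sub>F f \<in> H"
    and ip_add: "\<And>f g h. f \<in> H \<Longrightarrow> g \<in> H \<Longrightarrow> h \<in> H \<Longrightarrow> ip (f + g) h = ip f h + ip g h"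
    and ip_scale: "\<And>c f g. f \<in> H \<Longrightarrow> g \<in> H \<Longrightarrow> ip (c \<cdot>\<^sub>F f) g = c * ip f g"
    and ip_cnj: "\<And>f g. f \<in> H \<Longrightarrow> g \<in> H \<Longrightarrow> ip g f = cnj (ip f g)"
    and ip_pos: "\<And>f. f \<in> H \<Longrightarrow> f \<noteq> 0 \<Longrightarrow> Re (ip f f) > 0"
    and complete: "Metric_space.mcomplete H (hdist H ip)"
    and eval_continuous:
      "\<And>x. x \<in> \<Omega> \<Longrightarrow> continuous_map (Metric_space.mtopology H (hdist H ip)) euclidean (\<lambda>f. f x)"

definition bounded_op :: "('a \<Rightarrow> complex) set \<Rightarrow> 'a inner_prod \<Rightarrow> 'a operator \<Rightarrow> bool"
  where "bounded_op H ip A \<longleftrightarrow>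
    (\<forall>f\<in>H. A f \<in> H) \<and>
    (\<forall>f\<in>H. \<forall>g\<in>H. A (f + g) = A f + A g) \<and>
    (\<forall>c. \<forall>f\<in>H. A (c \<cdot>\<^sub>F f) = c \<cdot>\<^sub>F A f) \<and>
    (\<exists>C. \<forall>f\<in>H. hnorm ip (A f) \<le> C * hnorm ip f)"

definition op_norm :: "('a \<Rightarrow> complex) set \<Rightarrow> 'a inner_prod \<Rightarrow> 'a operator \<Rightarrow> real"
  where "op_norm H ip A = Sup {hnorm ip (A f) | f. f \<in> H \<and> hnorm ip f \<le> 1}"

definition adj :: "('a \<Rightarrow> complex) set \<Rightarrow> 'a inner_prod \<Rightarrow> 'a operator \<Rightarrow> 'a operator"
  where "adj H ip A = (\<lambda>g. THE h. h \<in> H \<and> (\<forall>f\<in>H. ip (A f) g = ip f h))"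

definition Im_op :: "('a \<Rightarrow> complex) set \<Rightarrow> 'a inner_prod \<Rightarrow> 'a operator \<Rightarrow> 'a operator"
  where "Im_op H ip A = (1 / (2 * \<i>)) \<cdot>\<^sub>O (A - adj H ip A)"

definition kernel :: "('a \<Rightarrow> complex) set \<Rightarrow> 'a inner_prod \<Rightarrow> 'a \<Rightarrow> 'a \<Rightarrow> complex"
  where "kernel H ip x = (THE k. k \<in> H \<and> (\<forall>f\<in>H. f x = ip f k))"

text \<open>
  If the kernel at \<open>x\<close> vanishes, then so does \<open>nkernel H ip x\<close>; such points never
  contribute to \<open>Ber\<close> below when \<open>q \<noteq> 0\<close>.
\<close>

definition nkernel :: "('a \<Rightarrow> complex) set \<Rightarrow> 'a inner_prod \<Rightarrow> 'a \<Rightarrow> 'a \<Rightarrow> complex"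
  where "nkernel H ip x = complex_of_real (1 / hnorm ip (kernel H ip x)) \<cdot>\<^sub>F kernel H ip x"

definition Ber ::
    "'a set \<Rightarrow> ('a \<Rightarrow> complex) set \<Rightarrow> 'a inner_prod \<Rightarrow> real \<Rightarrow> 'a operator \<Rightarrow> complex set"
  where "Ber \<Omega> H ip q A =
    {ip (A (nkernel H ip x)) (nkernel H ip y) | x y.
      x \<in> \<Omega> \<and> y \<in> \<Omega> \<and> ip (nkernel H ip x) (nkernel H ip y) = complex_of_real q}"

definition ber ::
    "'a set \<Rightarrow> ('a \<Rightarrow> complex) set \<Rightarrow> 'a inner_prod \<Rightarrow> real \<Rightarrow> 'a operator \<Rightarrow> real"
  where "ber \<Omega> H ip q A = (SUP z\<in>Ber \<Omega> H ip q A. cmod z)"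

definition sector :: "real \<Rightarrow> complex set"
  where "sector \<theta> = {z. Re z > 0 \<and> \<bar>Im z\<bar> \<le> tan \<theta> * Re z}"

definition sectorial_ops ::
    "'a set \<Rightarrow> ('a \<Rightarrow> complex) set \<Rightarrow> 'a inner_prod \<Rightarrow> real \<Rightarrow> real \<Rightarrow> 'a operator set"
  where "sectorial_ops \<Omega> H ip q \<theta> = {A. bounded_op H ip A \<and> Ber \<Omega> H ip q A \<subseteq> sector \<theta>}"

end

theory Submission
  imports Defs
begin

text \<open>
  With \<open>B = T\<^sup>*S\<close> one has \<open>S\<^sup>*S + T\<^sup>*T = (S - iT)\<^sup>*(S - iT) + 2 \<Im>(B)\<close>, so it remains to bound
  \<open>v = \<langle>\<Im>(B)a, b\<rangle>\<close> for normalized kernels \<open>a\<close>, \<open>b\<close> with \<open>\<langle>a, b\<rangle> = q\<close>.  As \<open>q\<close> is real, also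
  \<open>\<langle>b, a\<rangle> = q\<close>, hence both \<open>\<langle>Ba, b\<rangle>\<close> and \<open>\<langle>Bb, a\<rangle>\<close> lie in \<open>Ber\<^sub>q(B)\<close>, and \<open>Re v\<close> is the mean of
  their imaginary parts, at most \<open>sin \<theta> ber\<^sub>q(B)\<close> in modulus.  Since \<open>\<langle>\<Im>(B)a, a\<rangle>\<close> is real,
  \<open>Im v\<close> is the imaginary part of \<open>\<langle>\<Im>(B)a, b - qa\<rangle>\<close>, where \<open>b - qa\<close> has norm \<open>sqrt (1 - q\<^sup>2)\<close>.
\<close>

section \<open>The sine bound in a sector\<close>

text \<open>Multiplying the sector condition by \<open>cos \<theta>\<close> and squaring gives (Im
  z)^2 (1 - sin^2 \<theta>) \<le> sin^2 \<theta> (Re z)^2; moving the sine term across produces the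
  modulus.\<close>

lemma sector_Im_le:
  assumes "z \<in> sector \<theta>" "0 \<le> \<theta>" "\<theta> < pi / 2"
  shows "\<bar>Im z\<bar> \<le> sin \<theta> * cmod z"
proof -
  have c: "cos \<theta> > 0" and s: "sin \<theta> \<ge> 0"
    using assms by (auto intro: cos_gt_zero_pi sin_ge_zero)
  have "\<bar>Im z\<bar> * cos \<theta> \<le> tan \<theta> * Re z * cos \<theta>"
    using assms c by (intro mult_right_mono) (auto simp: sector_def)
  also have "\<dots> = sin \<theta> * Re z"
    using c by (simp add: tan_def)
  finally have "(\<bar>Im z\<bar> * cos \<theta>)\<^sup>2 \<le> (sin \<theta> * Re z)\<^sup>2"
    using c by (intro power_mono) auto
  then have "(Im z)\<^sup>2 * (1 - (sin \<theta>)\<^sup>2) \<le> (sin \<theta>)\<^sup>2 * (Re z)\<^sup>2"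
    by (simp add: power_mult_distrib cos_squared_eq)
  then have "\<bar>Im z\<bar>\<^sup>2 \<le> (sin \<theta> * cmod z)\<^sup>2"
    by (simp add: power_mult_distrib cmod_power2 algebra_simps)
  then show ?thesis
    by (rule power2_le_imp_le) (use s in simp)
qed

context rkhs
begin

section \<open>Inner product and norm\<close>

text \<open>The axioms of \<open>rkhs\<close> speak of sums and multiples only; every fact on
  differences is reduced to them by this rewriting.\<close>

lemma diff_eq_add_scale: "f - g = f + (-1) \<cdot>\<^sub>F g" for f g :: "'a \<Rightarrow> complex"
  by (auto simp: scale_fun_def)

lemma diff_mem: "f \<in> H \<Longrightarrow> g \<in> H \<Longrightarrow> f - g \<in> H"
  by (simp add: diff_eq_add_scale add_mem scale_mem)

lemma ip_diff: "f \<in> H \<Longrightarrow> g \<in> H \<Longrightarrow> h \<in> H \<Longrightarrow> ip (f - g) h = ip f h - ip g h"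
  by (simp add: diff_eq_add_scale ip_add ip_scale scale_mem)

lemma ip_add_right: "f \<in> H \<Longrightarrow> g \<in> H \<Longrightarrow> h \<in> H \<Longrightarrow> ip h (f + g) = ip h f + ip h g"
  by (metis add_mem ip_add ip_cnj complex_cnj_add)

lemma ip_scale_right: "f \<in> H \<Longrightarrow> h \<in> H \<Longrightarrow> ip h (c \<cdot>\<^sub>F f) = cnj c * ip h f"
  by (metis scale_mem ip_scale ip_cnj complex_cnj_mult)

lemma ip_diff_right: "f \<in> H \<Longrightarrow> g \<in> H \<Longrightarrow> h \<in> H \<Longrightarrow> ip h (f - g) = ip h f - ip h g"
  by (simp add: diff_eq_add_scale ip_add_right ip_scale_right scale_mem)

lemmas ip_linear = ip_add ip_diff ip_scale ip_add_right ip_diff_right ip_scale_right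
  add_mem diff_mem scale_mem

lemma ip_zero: "h \<in> H \<Longrightarrow> ip 0 h = 0" "h \<in> H \<Longrightarrow> ip h 0 = 0"
  using ip_diff[of h h h] ip_diff_right[of h h h] by auto

lemma ip_self_nonneg: "f \<in> H \<Longrightarrow> 0 \<le> Re (ip f f)"
  using ip_pos[of f] ip_zero[of f] by (cases "f = 0") auto

lemma hnorm_nonneg: "f \<in> H \<Longrightarrow> 0 \<le> hnorm ip f"
  by (simp add: hnorm_def ip_self_nonneg)

lemma hnorm_power2: "f \<in> H \<Longrightarrow> (hnorm ip f)\<^sup>2 = Re (ip f f)"
  by (simp add: hnorm_def ip_self_nonneg)

lemma ip_self: "f \<in> H \<Longrightarrow> ip f f = complex_of_real ((hnorm ip f)\<^sup>2)"
  using ip_cnj[of f f] by (simp add: hnorm_power2 complex_eq_iff)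

lemma hnorm_zero: "hnorm ip 0 = 0"
  by (simp add: hnorm_def ip_zero zero_mem)

lemma hnorm_eq_0_iff: "f \<in> H \<Longrightarrow> hnorm ip f = 0 \<longleftrightarrow> f = 0"
  using ip_pos[of f] hnorm_zero by (cases "f = 0") (auto simp: hnorm_def)

lemma hnorm_scale: "f \<in> H \<Longrightarrow> hnorm ip (c \<cdot>\<^sub>F f) = cmod c * hnorm ip f"
proof -
  assume f: "f \<in> H"
  have "ip (c \<cdot>\<^sub>F f) (c \<cdot>\<^sub>F f) = (c * cnj c) * ip f f"
    using f by (simp add: ip_linear)
  also have "\<dots> = complex_of_real ((cmod c * hnorm ip f)\<^sup>2)"
    using f by (simp add: complex_norm_square[symmetric] ip_self power_mult_distrib)
  finally show ?thesis
    using f by (simp add: hnorm_def[of _ "c \<cdot>\<^sub>F f"] hnorm_nonneg)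
qed

lemma cauchy_schwarz:
  assumes f: "f \<in> H" and g: "g \<in> H"
  shows "cmod (ip f g) \<le> hnorm ip f * hnorm ip g"
proof (cases "g = 0")
  case True
  then show ?thesis using f by (simp add: ip_zero hnorm_zero)
next
  case False
  define n where "n = (hnorm ip g)\<^sup>2"
  have n: "n > 0"
    using False g by (simp add: n_def hnorm_eq_0_iff)
  \<comment> \<open>\<open>c\<close> is the coefficient of the orthogonal projection of
    \<open>f\<close> onto \<open>g\<close>; the inequality is the nonnegativity of the squared norm
    of the residual.\<close>
  define c where "c = ip f g / complex_of_real n"
  have gf: "ip g f = cnj (ip f g)"
    using f g by (rule ip_cnj)
  have gg: "ip g g = complex_of_real n"
    using g by (simp add: n_def ip_self)
  have "ip (f - c \<cdot>\<^sub>F g) (f - c \<cdot>\<^sub>F g) = ip f f - ip f g * cnj (ip f g) / complex_of_real n"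
    using f g n by (simp add: ip_linear gf gg c_def field_simps)
  also have "\<dots> = complex_of_real ((hnorm ip f)\<^sup>2 - (cmod (ip f g))\<^sup>2 / n)"
    using f by (simp add: ip_self complex_norm_square[symmetric])
  finally have "0 \<le> (hnorm ip f)\<^sup>2 - (cmod (ip f g))\<^sup>2 / n"
    using ip_self_nonneg[of "f - c \<cdot>\<^sub>F g"] f g by (simp add: ip_linear)
  then have "(cmod (ip f g))\<^sup>2 \<le> (hnorm ip f * hnorm ip g)\<^sup>2"
    using n by (simp add: field_simps n_def power_mult_distrib)
  then show ?thesis
    by (rule power2_le_imp_le) (use f g in \<open>simp add: hnorm_nonneg\<close>)
qed

lemma hnorm_add_le:
  assumes f: "f \<in> H" and g: "g \<in> H"
  shows "hnorm ip (f + g) \<le> hnorm ip f + hnorm ip g"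
proof -
  have "(hnorm ip (f + g))\<^sup>2 = (hnorm ip f)\<^sup>2 + (hnorm ip g)\<^sup>2 + 2 * Re (ip f g)"
    using f g ip_cnj[of f g] by (simp add: hnorm_power2 ip_linear)
  also have "\<dots> \<le> (hnorm ip f + hnorm ip g)\<^sup>2"
    using cauchy_schwarz[OF f g] complex_Re_le_cmod[of "ip f g"]
    by (simp add: power2_sum)
  finally show ?thesis
    by (rule power2_le_imp_le) (use f g in \<open>simp add: hnorm_nonneg\<close>)
qed

lemma hnorm_diff_le: "f \<in> H \<Longrightarrow> g \<in> H \<Longrightarrow> hnorm ip (f - g) \<le> hnorm ip f + hnorm ip g"
  using hnorm_add_le[of f "(-1) \<cdot>\<^sub>F g"] by (simp add: diff_eq_add_scale scale_mem hnorm_scale)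

text \<open>The axioms \<open>complete\<close> and \<open>eval_continuous\<close> are phrased
  through \<open>Metric_space\<close>; this interpretation makes its facts on Cauchy sequences,
  limits and balls available for them.\<close>

sublocale hilbert: Metric_space H "hdist H ip"
proof
  fix f g h
  show "0 \<le> hdist H ip f g"
    by (simp add: hdist_def hnorm_nonneg diff_mem)
  have swap: "g - f = (-1) \<cdot>\<^sub>F (f - g)"
    by (auto simp: scale_fun_def)
  show "hdist H ip f g = hdist H ip g f"
    by (auto simp: hdist_def swap hnorm_scale diff_mem)
  show "hdist H ip f g = 0 \<longleftrightarrow> f = g" if "f \<in> H" "g \<in> H"
    using that by (simp add: hdist_def hnorm_eq_0_iff diff_mem)
  show "hdist H ip f h \<le> hdist H ip f g + hdist H ip g h" if "f \<in> H" "g \<in> H" "h \<in> H"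
    using that hnorm_add_le[of "f - g" "g - h"] by (simp add: hdist_def diff_mem)
qed

section \<open>Riesz representation, kernels and adjoints\<close>

text \<open>
  The representing vector minimizes \<open>J f = \<parallel>f\<parallel>\<^sup>2 - 2 Re (\<phi> f)\<close>; minimizing sequences are Cauchy by
  the parallelogram law.
\<close>

lemma riesz_representation:
  assumes add: "\<And>f g. f \<in> H \<Longrightarrow> g \<in> H \<Longrightarrow> \<phi> (f + g) = \<phi> f + \<phi> g"
    and scale: "\<And>c f. f \<in> H \<Longrightarrow> \<phi> (c \<cdot>\<^sub>F f) = c * \<phi> f"
    and bound: "\<And>f. f \<in> H \<Longrightarrow> cmod (\<phi> f) \<le> C * hnorm ip f"
  shows "\<exists>k\<in>H. \<forall>f\<in>H. \<phi> f = ip f k"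
proof -
  define J where "J f = Re (ip f f) - 2 * Re (\<phi> f)" for f
  define m where "m = Inf (J ` H)"
  \<comment> \<open>Completing the square: with n the norm of \<open>f\<close>, \<open>J f\<close>
    is at least n^2 - 2 C n = (n - C)^2 - C^2.\<close>
  have J_lower: "- C\<^sup>2 \<le> J f" if f: "f \<in> H" for f
  proof -
    have "Re (\<phi> f) \<le> C * hnorm ip f"
      using bound[OF f] complex_Re_le_cmod[of "\<phi> f"] by linarith
    moreover have "0 \<le> (hnorm ip f - C)\<^sup>2"
      by simp
    ultimately show ?thesis
      using f by (simp add: J_def hnorm_power2[symmetric] power2_diff algebra_simps)
  qed
  then have bdd: "bdd_below (J ` H)"
    by (intro bdd_belowI2)
  have m_le: "m \<le> J f" if "f \<in> H" for f
    unfolding m_def using bdd that by (intro cInf_lower) auto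
  have "\<exists>f\<in>H. J f < m + 1 / real (Suc n)" for n
    using cInf_lessD[of "J ` H" "m + 1 / real (Suc n)"] zero_mem by (auto simp: m_def)
  then obtain u where u: "\<And>n. u n \<in> H" and Ju: "\<And>n. J (u n) < m + 1 / real (Suc n)"
    by metis
  have Ju_lim: "(\<lambda>n. J (u n) - m) \<longlonglongrightarrow> 0"
  proof (rule tendsto_sandwich[OF _ _ tendsto_const LIMSEQ_inverse_real_of_nat])
    show "\<forall>\<^sub>F n in sequentially. 0 \<le> J (u n) - m"
      using m_le u by simp
    show "\<forall>\<^sub>F n in sequentially. J (u n) - m \<le> inverse (real (Suc n))"
      using Ju
      by (intro always_eventually allI) (simp add: less_imp_le inverse_eq_divide diff_le_eq add.commute)
  qed
  \<comment> \<open>The linear part of \<open>J\<close> cancels against the midpoint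
    \<open>h\<close>, so the parallelogram law becomes an identity for
    \<open>2 * J f + 2 * J g - 4 * J h\<close>, where \<open>J h\<close> is at least
    \<open>m\<close>.\<close>
  have par: "(hnorm ip (f - g))\<^sup>2 \<le> 2 * (J f - m) + 2 * (J g - m)" if f: "f \<in> H" and g: "g \<in> H" for f g
  proof -
    define h where "h = (1/2) \<cdot>\<^sub>F (f + g)"
    have h: "h \<in> H"
      using f g by (simp add: h_def ip_linear)
    have hh: "ip h h = (ip f f + ip g g + ip f g + ip g f) / 4"
      using f g by (simp add: h_def ip_linear field_simps flip: add_divide_distrib)
    have "4 * Re (ip h h) = Re (ip f f) + Re (ip g g) + Re (ip f g) + Re (ip g f)"
      by (simp add: hh)
    moreover have "2 * Re (\<phi> h) = Re (\<phi> f) + Re (\<phi> g)"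
      using f g by (simp add: h_def add scale ip_linear)
    moreover have "(hnorm ip (f - g))\<^sup>2 = Re (ip f f + ip g g - ip f g - ip g f)"
      using f g by (simp add: hnorm_power2 ip_linear)
    ultimately have "(hnorm ip (f - g))\<^sup>2 = 2 * J f + 2 * J g - 4 * J h"
      by (simp add: J_def)
    then show ?thesis
      using m_le[OF h] by simp
  qed
  have "hilbert.MCauchy u"
    unfolding hilbert.MCauchy_def
  proof (intro conjI allI impI)
    show "range u \<subseteq> H"
      using u by auto
    fix e :: real assume "e > 0"
    \<comment> \<open>With e^2/4 at both indices, the right-hand side of \<open>par\<close> stays
      below e^2.\<close>
    then have "\<forall>\<^sub>F n in sequentially. J (u n) - m < e\<^sup>2 / 4"
      by (intro order_tendstoD(2)[OF Ju_lim]) simp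
    then obtain N where N: "\<And>n. n \<ge> N \<Longrightarrow> J (u n) - m < e\<^sup>2 / 4"
      by (auto simp: eventually_sequentially)
    show "\<exists>N. \<forall>n n'. N \<le> n \<longrightarrow> N \<le> n' \<longrightarrow> hdist H ip (u n) (u n') < e"
    proof (intro exI allI impI)
      fix n n' assume n: "N \<le> n" and n': "N \<le> n'"
      have "(hnorm ip (u n - u n'))\<^sup>2 < e\<^sup>2"
        using par[OF u u, of n n'] N[OF n] N[OF n'] by simp
      then show "hdist H ip (u n) (u n') < e"
        using \<open>e > 0\<close> u by (simp add: hdist_def power2_less_imp_less)
    qed
  qed
  then obtain k where "limitin hilbert.mtopology u k sequentially"
    using complete by (auto simp: hilbert.mcomplete_def)
  then have k: "k \<in> H" and "(\<lambda>n. hdist H ip (u n) k) \<longlonglongrightarrow> 0"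
    by (auto simp: hilbert.limitin_metric_dist_null)
  then have u_lim: "(\<lambda>n. hnorm ip (u n - k)) \<longlonglongrightarrow> 0"
    using u by (simp add: hdist_def)
  \<comment> \<open>The first-order condition for the minimum at \<open>k\<close>. It concerns real
    parts only, since \<open>J\<close> sees only the real part of \<open>\<phi>\<close>.\<close>
  have Re_eq: "Re (ip h k) = Re (\<phi> h)" if h: "h \<in> H" for h
  proof -
    have ip_lim: "(\<lambda>n. Re (ip h (u n))) \<longlonglongrightarrow> Re (ip h k)"
    proof -
      have "(\<lambda>n. ip h (u n - k)) \<longlonglongrightarrow> 0"
      proof (rule Lim_null_comparison)
        show "\<forall>\<^sub>F n in sequentially. cmod (ip h (u n - k)) \<le> hnorm ip h * hnorm ip (u n - k)"
          using cauchy_schwarz h u k by (simp add: diff_mem)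
        show "(\<lambda>n. hnorm ip h * hnorm ip (u n - k)) \<longlonglongrightarrow> 0"
          using tendsto_mult_left[OF u_lim, of "hnorm ip h"] by simp
      qed
      then have "(\<lambda>n. ip h (u n)) \<longlonglongrightarrow> ip h k"
        using h u k by (subst (asm) ip_diff_right) (auto simp: LIM_zero_iff)
      then show ?thesis
        by (rule tendsto_Re)
    qed
    \<comment> \<open>This is J(k + t h) \<ge> J(k) expanded. It is obtained as the limit of J(u n +
      t h) \<ge> m, so that only the convergence of \<open>J (u n)\<close> and of
      \<open>ip h (u n)\<close> enters.\<close>
    have quad: "0 \<le> t\<^sup>2 * Re (ip h h) + 2 * t * (Re (ip h k) - Re (\<phi> h))" for t :: real
    proof (rule tendsto_lowerbound)
      show "(\<lambda>n. (J (u n) - m) + (t\<^sup>2 * Re (ip h h) + 2 * t * (Re (ip h (u n)) - Re (\<phi> h))))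
          \<longlonglongrightarrow> t\<^sup>2 * Re (ip h h) + 2 * t * (Re (ip h k) - Re (\<phi> h))"
        by (rule tendsto_eq_intros Ju_lim ip_lim refl | simp)+
      have "0 \<le> (J (u n) - m) + (t\<^sup>2 * Re (ip h h) + 2 * t * (Re (ip h (u n)) - Re (\<phi> h)))" for n
      proof -
        have "m \<le> J (u n + complex_of_real t \<cdot>\<^sub>F h)"
          using u h by (intro m_le) (simp add: ip_linear)
        moreover have "Re (ip (u n) h) = Re (ip h (u n))"
          using ip_cnj[OF u h, of n] by simp
        ultimately show ?thesis
          using u h by (simp add: J_def add scale ip_linear power2_eq_square algebra_simps)
      qed
      then show "\<forall>\<^sub>F n in sequentially.
          0 \<le> (J (u n) - m) + (t\<^sup>2 * Re (ip h h) + 2 * t * (Re (ip h (u n)) - Re (\<phi> h)))"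
        by simp
    qed simp
    define d where "d = Re (ip h k) - Re (\<phi> h)"
    define r where "r = Re (ip h h)"
    have r: "r \<ge> 0"
      using h by (simp add: r_def ip_self_nonneg)
    \<comment> \<open>The minimizing t would be -d/r; the denominator r + 1 avoids the case r = 0
      and still makes the quadratic negative unless d = 0.\<close>
    have "0 \<le> (- d / (r + 1))\<^sup>2 * r + 2 * (- d / (r + 1)) * d"
      using quad[of "- d / (r + 1)"] by (simp add: d_def r_def)
    also have "\<dots> = - (d\<^sup>2 * (r + 2)) / (r + 1)\<^sup>2"
      using r by (simp add: field_simps power2_eq_square add_nonneg_eq_0_iff)
    finally have "d\<^sup>2 * (r + 2) / (r + 1)\<^sup>2 \<le> 0"
      by simp
    moreover have "(r + 1)\<^sup>2 > 0"
      using r by simp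
    ultimately have "d\<^sup>2 * (r + 2) \<le> 0"
      by (simp only: divide_le_0_iff) auto
    then have "d = 0"
      using r by (simp add: mult_le_0_iff)
    then show ?thesis
      by (simp add: d_def)
  qed
  \<comment> \<open>Since Re (i z) = - Im z, the real parts at \<open>\<i> \<cdot>\<^sub>F h\<close>
    supply the imaginary parts at \<open>h\<close>.\<close>
  have "\<phi> h = ip h k" if h: "h \<in> H" for h
    using Re_eq[OF h] Re_eq[OF scale_mem[OF h, of \<i>]] h k
    by (simp add: complex_eq_iff ip_scale scale)
  then show ?thesis
    using k by blast
qed

text \<open>The uniqueness half of the Riesz representation, on which the definite descriptions in
  \<open>kernel\<close> and \<open>adj\<close> rest.\<close>

lemma ip_right_cancel:
  assumes "k \<in> H" "l \<in> H" "\<forall>f\<in>H. ip f k = ip f l"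
  shows "k = l"
proof -
  have "ip (k - l) (k - l) = 0"
    using assms diff_mem[of k l] by (simp add: ip_diff_right)
  then show ?thesis
    using hnorm_eq_0_iff[of "k - l"] assms by (simp add: hnorm_def diff_mem)
qed

section \<open>Bounded point evaluations and reproducing kernels\<close>

text \<open>Continuity at 0 yields a ball on which the values at \<open>x\<close> are below 1 in
  modulus; homogeneity turns this into a linear bound, the hypothesis of the Riesz
  representation.\<close>

lemma eval_bounded:
  assumes x: "x \<in> \<Omega>"
  shows "\<exists>C. \<forall>f\<in>H. cmod (f x) \<le> C * hnorm ip f"
proof -
  have "openin hilbert.mtopology {f \<in> topspace hilbert.mtopology. f x \<in> ball 0 1}"
    using eval_continuous[OF x] by (rule openin_continuous_map_preimage) simp
  moreover have "0 \<in> {f \<in> topspace hilbert.mtopology. f x \<in> ball 0 1}"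
    by (simp add: zero_mem)
  ultimately obtain r where r: "r > 0"
      and sub: "hilbert.mball 0 r \<subseteq> {f \<in> topspace hilbert.mtopology. f x \<in> ball 0 1}"
    by (meson hilbert.openin_mtopology)
  have small: "cmod (f x) < 1" if f: "f \<in> H" "hnorm ip f < r" for f
  proof -
    have "hdist H ip 0 f = hnorm ip f"
      using f hilbert.commute[of 0 f] by (simp add: hdist_def zero_mem)
    then have "f \<in> hilbert.mball 0 r"
      using f by (simp add: zero_mem)
    then show ?thesis
      using sub by auto
  qed
  have "cmod (f x) \<le> 2 / r * hnorm ip f" if f: "f \<in> H" for f
  proof (cases "f = 0")
    case False
    define n where "n = hnorm ip f"
    have n: "n > 0"
      using False f hnorm_nonneg[of f] hnorm_eq_0_iff[of f] by (simp add: n_def)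
    \<comment> \<open>The vector \<open>f\<close> is rescaled to norm r/2, strictly inside the
      ball.\<close>
    have "cmod ((complex_of_real (r / (2 * n)) \<cdot>\<^sub>F f) x) < 1"
      using f r n by (intro small scale_mem)
        (simp_all add: hnorm_scale n_def[symmetric] norm_divide norm_mult)
    then have "r / (2 * n) * cmod (f x) < 1"
      using r n by (simp add: scale_fun_def norm_mult norm_divide)
    then show ?thesis
      using r n by (simp add: n_def[symmetric] field_simps)
  qed (simp add: hnorm_zero)
  then show ?thesis
    by blast
qed

lemma kernel_mem: "x \<in> \<Omega> \<Longrightarrow> kernel H ip x \<in> H"
proof -
  assume "x \<in> \<Omega>"
  then obtain C where "\<forall>f\<in>H. cmod (f x) \<le> C * hnorm ip f"
    using eval_bounded by blast
  then obtain k where "k \<in> H" "\<forall>f\<in>H. f x = ip f k"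
    using riesz_representation[of "\<lambda>f. f x" C] by (auto simp: scale_fun_def)
  then have "\<exists>!k. k \<in> H \<and> (\<forall>f\<in>H. f x = ip f k)"
    by (intro ex1I[of _ k]) (auto intro!: ip_right_cancel)
  then have "kernel H ip x \<in> H \<and> (\<forall>f\<in>H. f x = ip f (kernel H ip x))"
    unfolding kernel_def by (rule theI')
  then show ?thesis ..
qed

lemma nkernel_mem: "x \<in> \<Omega> \<Longrightarrow> nkernel H ip x \<in> H"
  by (simp add: nkernel_def kernel_mem scale_mem)

lemma hnorm_nkernel:
  assumes "x \<in> \<Omega>" "nkernel H ip x \<noteq> 0"
  shows "hnorm ip (nkernel H ip x) = 1"
proof -
  have "hnorm ip (kernel H ip x) \<noteq> 0"
    using assms(2) by (auto simp: nkernel_def scale_fun_def)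
  then show ?thesis
    using hnorm_nonneg[OF kernel_mem[OF assms(1)]]
    by (simp add: nkernel_def hnorm_scale kernel_mem[OF assms(1)] norm_divide)
qed

section \<open>Bounded operators, adjoints and the operator norm\<close>

lemma bounded_opD:
  assumes "bounded_op H ip A"
  shows "f \<in> H \<Longrightarrow> A f \<in> H"
    and "f \<in> H \<Longrightarrow> g \<in> H \<Longrightarrow> A (f + g) = A f + A g"
    and "f \<in> H \<Longrightarrow> A (c \<cdot>\<^sub>F f) = c \<cdot>\<^sub>F A f"
  using assms by (auto simp: bounded_op_def)

lemma bounded_op_bound:
  assumes "bounded_op H ip A"
  obtains C where "C \<ge> 0" "\<And>f. f \<in> H \<Longrightarrow> hnorm ip (A f) \<le> C * hnorm ip f"
proof -
  obtain C where "\<forall>f\<in>H. hnorm ip (A f) \<le> C * hnorm ip f"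
    using assms by (auto simp: bounded_op_def)
  then have "\<forall>f\<in>H. hnorm ip (A f) \<le> \<bar>C\<bar> * hnorm ip f"
    by (meson abs_ge_self hnorm_nonneg mult_right_mono order_trans)
  then show thesis
    using that[of "\<bar>C\<bar>"] by simp
qed

text \<open>The Riesz representation applies to the functional taking \<open>f\<close> to
  \<open>ip (A f) g\<close>, with the norm of \<open>g\<close> absorbed into the constant.\<close>

lemma adj_correct:
  assumes A: "bounded_op H ip A" and g: "g \<in> H"
  shows "adj H ip A g \<in> H \<and> (\<forall>f\<in>H. ip (A f) g = ip f (adj H ip A g))"
proof -
  obtain C where C: "\<And>f. f \<in> H \<Longrightarrow> hnorm ip (A f) \<le> C * hnorm ip f"
    using bounded_op_bound[OF A] by blast
  have "cmod (ip (A f) g) \<le> (C * hnorm ip g) * hnorm ip f" if f: "f \<in> H" for f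
    using cauchy_schwarz[OF bounded_opD(1)[OF A f] g] mult_right_mono[OF C[OF f] hnorm_nonneg[OF g]]
    by (simp add: mult_ac)
  moreover have "ip (A (f + h)) g = ip (A f) g + ip (A h) g" if "f \<in> H" "h \<in> H" for f h
    unfolding bounded_opD(2)[OF A that] using that g by (intro ip_add bounded_opD(1)[OF A])
  moreover have "ip (A (c \<cdot>\<^sub>F f)) g = c * ip (A f) g" if "f \<in> H" for c f
    unfolding bounded_opD(3)[OF A that] using that g by (intro ip_scale bounded_opD(1)[OF A])
  ultimately obtain k where "k \<in> H" "\<forall>f\<in>H. ip (A f) g = ip f k"
    using riesz_representation[of "\<lambda>f. ip (A f) g"] by blast
  then have "\<exists>!k. k \<in> H \<and> (\<forall>f\<in>H. ip (A f) g = ip f k)"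
    by (intro ex1I[of _ k]) (auto intro!: ip_right_cancel)
  then show ?thesis
    unfolding adj_def by (rule theI')
qed

lemma adj_mem: "bounded_op H ip A \<Longrightarrow> g \<in> H \<Longrightarrow> adj H ip A g \<in> H"
  using adj_correct by blast

lemma ip_adj: "bounded_op H ip A \<Longrightarrow> f \<in> H \<Longrightarrow> g \<in> H \<Longrightarrow> ip f (adj H ip A g) = ip (A f) g"
  using adj_correct by metis

lemma ip_adj_left: "bounded_op H ip A \<Longrightarrow> f \<in> H \<Longrightarrow> g \<in> H \<Longrightarrow> ip (adj H ip A g) f = ip g (A f)"
  by (metis adj_mem bounded_opD(1) ip_adj ip_cnj)

text \<open>For h = A*g one has |h|^2 = <A h, g> \<le> C |h| |g|, and one factor |h|
  cancels.\<close>

lemma hnorm_adj_le: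
  assumes A: "bounded_op H ip A"
    and C: "C \<ge> 0" "\<And>f. f \<in> H \<Longrightarrow> hnorm ip (A f) \<le> C * hnorm ip f" and g: "g \<in> H"
  shows "hnorm ip (adj H ip A g) \<le> C * hnorm ip g"
proof -
  define h where "h = adj H ip A g"
  have h: "h \<in> H"
    using A g by (simp add: h_def adj_mem)
  have "(hnorm ip h)\<^sup>2 = Re (ip (A h) g)"
    using A g h by (simp add: hnorm_power2 h_def ip_adj)
  also have "\<dots> \<le> hnorm ip (A h) * hnorm ip g"
    using cauchy_schwarz[OF bounded_opD(1)[OF A h] g] complex_Re_le_cmod[of "ip (A h) g"] by linarith
  also have "\<dots> \<le> C * hnorm ip h * hnorm ip g"
    using C h g by (intro mult_right_mono) (auto simp: hnorm_nonneg)
  finally have "hnorm ip h * hnorm ip h \<le> hnorm ip h * (C * hnorm ip g)"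
    by (simp add: power2_eq_square mult_ac)
  then have "hnorm ip h \<le> C * hnorm ip g"
    using C g h hnorm_nonneg[OF h] hnorm_nonneg[OF g] by (cases "hnorm ip h = 0") auto
  then show ?thesis
    by (simp add: h_def)
qed

text \<open>A real \<open>Sup\<close> is known to dominate its set only when the set is bounded
  above; \<open>C\<close> guarantees this.\<close>

lemma hnorm_le_op_norm:
  assumes C: "\<And>f. f \<in> H \<Longrightarrow> hnorm ip (A f) \<le> C * hnorm ip f"
    and f: "f \<in> H" "hnorm ip f \<le> 1"
  shows "hnorm ip (A f) \<le> op_norm H ip A"
  unfolding op_norm_def
proof (rule cSup_upper)
  show "hnorm ip (A f) \<in> {hnorm ip (A f) | f. f \<in> H \<and> hnorm ip f \<le> 1}"
    using f by blast
  \<comment> \<open>The absolute value covers a negative \<open>C\<close>, for which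
    \<open>C * hnorm ip g\<close> is largest at \<open>g = 0\<close>.\<close>
  have "hnorm ip (A g) \<le> \<bar>C\<bar>" if g: "g \<in> H" "hnorm ip g \<le> 1" for g
  proof -
    have "C * hnorm ip g \<le> \<bar>C\<bar> * 1"
      using g hnorm_nonneg by (intro mult_mono) auto
    then show ?thesis
      using C[OF g(1)] by linarith
  qed
  then show "bdd_above {hnorm ip (A f) | f. f \<in> H \<and> hnorm ip f \<le> 1}"
    by (intro bdd_aboveI[of _ "\<bar>C\<bar>"]) blast
qed

section \<open>The inequality for a pair of unit vectors\<close>

text \<open>The adjoint inherits the bound \<open>C\<close> of \<open>B\<close>, so half the
  difference of the two is again bounded by \<open>C\<close>.\<close>

lemma hnorm_Im_op_le_op_norm:
  assumes B: "bounded_op H ip B" and f: "f \<in> H" "hnorm ip f \<le> 1"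
  shows "hnorm ip (Im_op H ip B f) \<le> op_norm H ip (Im_op H ip B)"
proof -
  obtain C where C: "C \<ge> 0" "\<And>f. f \<in> H \<Longrightarrow> hnorm ip (B f) \<le> C * hnorm ip f"
    using bounded_op_bound[OF B] by blast
  have "hnorm ip (Im_op H ip B g) \<le> C * hnorm ip g" if g: "g \<in> H" for g
    using hnorm_diff_le[OF bounded_opD(1)[OF B g] adj_mem[OF B g]] C(2)[OF g] hnorm_adj_le[OF B C g]
    by (simp add: Im_op_def scale_op_def hnorm_scale diff_mem bounded_opD[OF B] adj_mem[OF B] g
        norm_divide norm_mult)
  then show ?thesis
    using f by (rule hnorm_le_op_norm)
qed

lemma hnorm_diff_scale_le_op_norm:
  assumes S: "bounded_op H ip S" and T: "bounded_op H ip T" and f: "f \<in> H" "hnorm ip f \<le> 1"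
  shows "hnorm ip ((S - c \<cdot>\<^sub>O T) f) \<le> op_norm H ip (S - c \<cdot>\<^sub>O T)"
proof -
  obtain C where C: "\<And>f. f \<in> H \<Longrightarrow> hnorm ip (S f) \<le> C * hnorm ip f"
    using bounded_op_bound[OF S] by blast
  obtain D where D: "\<And>f. f \<in> H \<Longrightarrow> hnorm ip (T f) \<le> D * hnorm ip f"
    using bounded_op_bound[OF T] by blast
  have "hnorm ip ((S - c \<cdot>\<^sub>O T) g) \<le> (C + cmod c * D) * hnorm ip g" if g: "g \<in> H" for g
    using hnorm_diff_le[OF bounded_opD(1)[OF S g] scale_mem[OF bounded_opD(1)[OF T g]], of c]
      C[OF g] mult_left_mono[OF D[OF g], of "cmod c"]
    by (simp add: scale_op_def hnorm_scale bounded_opD[OF T] g algebra_simps)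
  then show ?thesis
    using f by (rule hnorm_le_op_norm)
qed

lemma ip_Im_op:
  assumes "bounded_op H ip B" "a \<in> H" "b \<in> H"
  shows "ip (Im_op H ip B a) b = (ip (B a) b - cnj (ip (B b) a)) / (2 * \<i>)"
  using assms ip_cnj[of "B b" a]
  by (simp add: Im_op_def scale_op_def ip_linear bounded_opD adj_mem ip_adj_left)

lemma Im_op_mem:
  assumes "bounded_op H ip B" "a \<in> H"
  shows "Im_op H ip B a \<in> H"
  using assms by (simp add: Im_op_def scale_op_def ip_linear bounded_opD adj_mem)

text \<open>\<open>M\<close> bounds imaginary parts rather than moduli, so that the sector condition
  can enter with its factor \<open>sin \<theta>\<close>.\<close>

lemma cmod_ip_Im_op_le:
  assumes B: "bounded_op H ip B" and a: "a \<in> H" "hnorm ip a = 1" and b: "b \<in> H" "hnorm ip b = 1"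
    and ab: "ip a b = complex_of_real q"
    and M: "\<bar>Im (ip (B a) b)\<bar> \<le> M" "\<bar>Im (ip (B b) a)\<bar> \<le> M"
  shows "cmod (ip (Im_op H ip B a) b) \<le> M + sqrt (1 - q\<^sup>2) * op_norm H ip (Im_op H ip B)"
proof -
  \<comment> \<open>\<open>d\<close> is the component of \<open>b\<close> orthogonal to
    \<open>a\<close>; its norm follows from Pythagoras.\<close>
  define d where "d = b - complex_of_real q \<cdot>\<^sub>F a"
  have d: "d \<in> H"
    using a b by (simp add: d_def ip_linear)
  have ba: "ip b a = complex_of_real q"
    using ip_cnj[OF a(1) b(1)] ab by simp
  have "(hnorm ip d)\<^sup>2 = 1 - q\<^sup>2"
    unfolding hnorm_power2[OF d] unfolding d_def
    using a b ab ba ip_self[OF a(1)] ip_self[OF b(1)]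
    by (simp add: ip_linear power2_eq_square)
  then have nd: "hnorm ip d = sqrt (1 - q\<^sup>2)"
    using hnorm_nonneg[OF d] real_sqrt_unique by metis
  define y where "y = Im_op H ip B a"
  have y: "y \<in> H"
    using B a by (simp add: y_def Im_op_mem)
  have "ip y b = complex_of_real q * ip y a + ip y d"
    using a b y by (simp add: d_def ip_linear)
  moreover have "Im (ip y a) = 0"
    using ip_Im_op[OF B a(1) a(1)] by (simp add: y_def complex_eq_iff)
  ultimately have "\<bar>Im (ip y b)\<bar> = \<bar>Im (ip y d)\<bar>"
    by simp
  also have "\<dots> \<le> hnorm ip y * hnorm ip d"
    using abs_Im_le_cmod[of "ip y d"] cauchy_schwarz[OF y d] by linarith
  also have "\<dots> \<le> op_norm H ip (Im_op H ip B) * hnorm ip d"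
    using hnorm_Im_op_le_op_norm[OF B a(1)] a hnorm_nonneg[OF d]
    by (intro mult_right_mono) (auto simp: y_def)
  finally have "\<bar>Im (ip y b)\<bar> \<le> sqrt (1 - q\<^sup>2) * op_norm H ip (Im_op H ip B)"
    by (simp add: nd mult.commute)
  \<comment> \<open>Conjugation flips the sign of the imaginary part, so the difference in
    \<open>ip_Im_op\<close> becomes a sum.\<close>
  moreover have "ip (B a) b = cnj (ip (B b) a) + 2 * \<i> * ip y b"
    by (simp add: y_def ip_Im_op[OF B a(1) b(1)])
  from arg_cong[OF this, of Im] have "Re (ip y b) = (Im (ip (B a) b) + Im (ip (B b) a)) / 2"
    by simp
  then have "\<bar>Re (ip y b)\<bar> \<le> M"
    using M by (auto simp: abs_le_iff)
  ultimately show ?thesis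
    using cmod_le[of "ip y b"] by (simp add: y_def)
qed

text \<open>The operator identity is used in its weak form: all outer adjoints are moved to the
  right-hand vector, and \<open>ip (R a) (R b)\<close> stands for the term with (S - iT)*(S -
  iT).\<close>

lemma cmod_ip_sum_squares_le:
  assumes S: "bounded_op H ip S" and T: "bounded_op H ip T"
    and B: "bounded_op H ip (adj H ip T \<circ> S)"
    and a: "a \<in> H" "hnorm ip a = 1" and b: "b \<in> H" "hnorm ip b = 1"
  shows "cmod (ip (((adj H ip S \<circ> S) + (adj H ip T \<circ> T)) a) b)
    \<le> (op_norm H ip (S - \<i> \<cdot>\<^sub>O T))\<^sup>2 + 2 * cmod (ip (Im_op H ip (adj H ip T \<circ> S) a) b)"
proof -
  define N where "N = op_norm H ip (S - \<i> \<cdot>\<^sub>O T)"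
  define R where "R = S - \<i> \<cdot>\<^sub>O T"
  have R: "R f \<in> H" if "f \<in> H" for f
    using that S T by (simp add: R_def scale_op_def ip_linear bounded_opD)
  have "hnorm ip (R a) \<le> N" "hnorm ip (R b) \<le> N"
    using hnorm_diff_scale_le_op_norm[OF S T, of _ \<i>] a b by (auto simp: R_def N_def)
  then have "hnorm ip (R a) * hnorm ip (R b) \<le> N * N"
    using hnorm_nonneg[OF R[OF a(1)]] hnorm_nonneg[OF R[OF b(1)]] by (intro mult_mono) auto
  then have RN: "cmod (ip (R a) (R b)) \<le> N\<^sup>2"
    using cauchy_schwarz[OF R[OF a(1)] R[OF b(1)]] by (simp add: power2_eq_square)
  have mem: "S a \<in> H" "S b \<in> H" "T a \<in> H" "T b \<in> H"
    using S T a b by (auto simp: bounded_opD)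
  have Bab: "ip ((adj H ip T \<circ> S) a) b = ip (S a) (T b)"
    using T b mem by (simp add: ip_adj_left)
  have Bba: "cnj (ip ((adj H ip T \<circ> S) b) a) = ip (T a) (S b)"
    using T a mem ip_cnj[OF mem(2,3)] by (simp add: ip_adj_left)
  have "ip (((adj H ip S \<circ> S) + (adj H ip T \<circ> T)) a) b = ip (S a) (S b) + ip (T a) (T b)"
    using S T a b mem by (simp add: ip_linear adj_mem ip_adj_left)
  moreover have "2 * ip (Im_op H ip (adj H ip T \<circ> S) a) b = - \<i> * (ip (S a) (T b) - ip (T a) (S b))"
    unfolding ip_Im_op[OF B a(1) b(1)] Bab Bba by (simp add: complex_eq_iff)
  moreover have "ip (R a) (R b)
      = ip (S a) (S b) + ip (T a) (T b) + \<i> * (ip (S a) (T b) - ip (T a) (S b))"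
    using mem by (simp add: R_def scale_op_def ip_linear algebra_simps)
  ultimately have "ip (((adj H ip S \<circ> S) + (adj H ip T \<circ> T)) a) b
      = ip (R a) (R b) + 2 * ip (Im_op H ip (adj H ip T \<circ> S) a) b"
    by simp
  then show ?thesis
    using RN norm_triangle_ineq[of "ip (R a) (R b)" "2 * ip (Im_op H ip (adj H ip T \<circ> S) a) b"]
    by (simp add: N_def norm_mult)
qed

section \<open>Normalized kernels and the supremum over admissible pairs\<close>

text \<open>A vanishing normalized kernel would force the inner product to be 0.\<close>

lemma hnorm_nkernel_pair:
  assumes "x \<in> \<Omega>" "y \<in> \<Omega>" "ip (nkernel H ip x) (nkernel H ip y) \<noteq> 0"
  shows "hnorm ip (nkernel H ip x) = 1" "hnorm ip (nkernel H ip y) = 1"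
  using assms ip_zero[OF nkernel_mem] by (auto intro!: hnorm_nkernel)

text \<open>This makes \<open>ber\<close> a genuine upper bound of the moduli: between unit vectors,
  Cauchy-Schwarz bounds each of them by \<open>C\<close>.\<close>

lemma bdd_above_cmod_Ber:
  assumes A: "bounded_op H ip A" and q: "q \<noteq> 0"
  shows "bdd_above (cmod ` Ber \<Omega> H ip q A)"
proof -
  obtain C where C: "\<And>f. f \<in> H \<Longrightarrow> hnorm ip (A f) \<le> C * hnorm ip f"
    using bounded_op_bound[OF A] by blast
  have "cmod (ip (A (nkernel H ip x)) (nkernel H ip y)) \<le> C"
    if xy: "x \<in> \<Omega>" "y \<in> \<Omega>" "ip (nkernel H ip x) (nkernel H ip y) = complex_of_real q" for x y
    using hnorm_nkernel_pair[OF xy(1,2)] xy(3) q C[OF nkernel_mem[OF xy(1)]]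
      cauchy_schwarz[OF bounded_opD(1)[OF A nkernel_mem[OF xy(1)]] nkernel_mem[OF xy(2)]]
    by simp
  then show ?thesis
    by (intro bdd_aboveI[of _ C]) (auto simp: Ber_def)
qed

end

theorem theorem2p5:
  fixes \<Omega> :: "'a set" and H :: "('a \<Rightarrow> complex) set" and ip :: "'a inner_prod"
    and S T :: "'a operator" and q \<theta> :: real
  assumes "rkhs \<Omega> H ip"
    and "0 < q" "q < 1"
    and "0 \<le> \<theta>" "\<theta> < pi / 2"
    and "bounded_op H ip S" "bounded_op H ip T"
    and "Ber \<Omega> H ip q (adj H ip T \<circ> S) \<noteq> {}"
    and "adj H ip T \<circ> S \<in> sectorial_ops \<Omega> H ip q \<theta>"
  shows "ber \<Omega> H ip q ((adj H ip S \<circ> S) + (adj H ip T \<circ> T))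
    \<le> (op_norm H ip (S - \<i> \<cdot>\<^sub>O T))\<^sup>2
      + 2 * ((sin \<theta> + 4 * sqrt (1 - q\<^sup>2) / q) * ber \<Omega> H ip q (adj H ip T \<circ> S)
             + sqrt (1 - q\<^sup>2) * op_norm H ip (Im_op H ip (adj H ip T \<circ> S)))"
proof -
  interpret rkhs \<Omega> H ip by fact
  define B where "B = adj H ip T \<circ> S"
  define M where "M = ber \<Omega> H ip q B"
  define G where "G = op_norm H ip (Im_op H ip B)"
  let ?N = "op_norm H ip (S - \<i> \<cdot>\<^sub>O T)"
  let ?P = "(adj H ip S \<circ> S) + (adj H ip T \<circ> T)"
  have B: "bounded_op H ip B" and sect: "Ber \<Omega> H ip q B \<subseteq> sector \<theta>" and ne: "Ber \<Omega> H ip q B \<noteq> {}"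
    using assms(8,9) by (auto simp: sectorial_ops_def B_def)
  have sin: "sin \<theta> \<ge> 0"
    using assms by (auto intro: sin_ge_zero)
  have M_upper: "cmod z \<le> M" if "z \<in> Ber \<Omega> H ip q B" for z
    unfolding M_def ber_def using bdd_above_cmod_Ber[OF B, of q] that assms(2)
    by (intro cSUP_upper) auto
  then have "M \<ge> 0"
    using ne norm_ge_zero order_trans by blast
  have Im_le: "\<bar>Im z\<bar> \<le> sin \<theta> * M" if "z \<in> Ber \<Omega> H ip q B" for z
    using sector_Im_le[of z \<theta>] sect that assms(4,5) mult_left_mono[OF M_upper[OF that] sin]
    by (meson order_trans subsetD)
  have pair: "cmod (ip (?P (nkernel H ip x)) (nkernel H ip y))
      \<le> ?N\<^sup>2 + 2 * (sin \<theta> * M + sqrt (1 - q\<^sup>2) * G)"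
    if xy: "x \<in> \<Omega>" "y \<in> \<Omega>" "ip (nkernel H ip x) (nkernel H ip y) = complex_of_real q" for x y
  proof -
    define a where "a = nkernel H ip x"
    define b where "b = nkernel H ip y"
    have a: "a \<in> H" "hnorm ip a = 1" and b: "b \<in> H" "hnorm ip b = 1"
      using xy nkernel_mem hnorm_nkernel_pair[OF xy(1,2)] assms(2) by (auto simp: a_def b_def)
    have ab: "ip a b = complex_of_real q"
      using xy by (simp add: a_def b_def)
    then have ba: "ip b a = complex_of_real q"
      using ip_cnj[OF a(1) b(1)] by simp
    \<comment> \<open>The second membership takes the two points in reversed order.\<close>
    have "ip (B a) b \<in> Ber \<Omega> H ip q B" "ip (B b) a \<in> Ber \<Omega> H ip q B"
      using xy ba unfolding Ber_def a_def b_def by blast+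
    then have "cmod (ip (Im_op H ip B a) b) \<le> sin \<theta> * M + sqrt (1 - q\<^sup>2) * G"
      unfolding G_def by (intro cmod_ip_Im_op_le B a b ab Im_le)
    then show ?thesis
      using order_trans[OF cmod_ip_sum_squares_le[OF assms(6,7) B[unfolded B_def] a b]]
      unfolding B_def a_def b_def by simp
  qed
  have "ber \<Omega> H ip q ?P \<le> ?N\<^sup>2 + 2 * (sin \<theta> * M + sqrt (1 - q\<^sup>2) * G)"
    unfolding ber_def
  proof (rule cSUP_least)
    show "Ber \<Omega> H ip q ?P \<noteq> {}"
      using ne by (auto simp: Ber_def)
    show "cmod z \<le> ?N\<^sup>2 + 2 * (sin \<theta> * M + sqrt (1 - q\<^sup>2) * G)" if "z \<in> Ber \<Omega> H ip q ?P" for z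
      using that pair unfolding Ber_def by blast
  qed
  \<comment> \<open>The remaining part of the coefficient of \<open>M\<close> is nonnegative, so
    adding it only enlarges the bound.\<close>
  also have "\<dots> \<le> ?N\<^sup>2 + 2 * ((sin \<theta> + 4 * sqrt (1 - q\<^sup>2) / q) * M + sqrt (1 - q\<^sup>2) * G)"
  proof -
    have "0 \<le> 4 * sqrt (1 - q\<^sup>2) / q * M"
      using \<open>M \<ge> 0\<close> assms(2,3) by (simp add: power_le_one)
    then show ?thesis
      by (simp add: distrib_right)
  qed
  finally show ?thesis
    by (simp add: M_def G_def B_def)
qed

end
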